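(* Let $(\mathfrak{g},[\cdot,\cdots,\cdot],\alpha)$ be an $n$-ary multiplicative Hom-Nambu-Lie superalgebra and let $\beta:\mathfrak{g}\to\mathfrak{g}$ be a morphism of $\mathfrak{g}$ such that $\beta\circ\alpha=\alpha\circ\beta$. Then $(\mathfrak{g},\beta\circ[\cdot,\cdots,\cdot],\beta\circ\alpha)$ is an $n$-ary multiplicative Hom-Nambu-Lie superalgebra.
   Context: For a $\mathbb{Z}_2$-graded vector space $\mathfrak g=\mathfrak g_{\bar 0}\oplus\mathfrak g_{\bar 1}$ over a field $\mathbb{K}$, $|x|\in\mathbb{Z}_2$ denotes the degree of a homogeneous element $x$; whenever $|x|$ appears, $x$ is assumed homogeneous. A linear map is even if it preserves degrees. An $n$-ary multiplicative Hom-Nambu-Lie superalgebra is a triple $(\mathfrak g,[\cdot,\cdots,\cdot],\alpha)$ consisting of a $\mathbb{Z}_2$-graded vector space $\mathfrak g$, an $n$-linear map $[\cdot,\cdots,\cdot]:\mathfrak g\times\cdots\times\mathfrak g\to\mathfrak g$ and an even linear map $\alpha:\mathfrak g\to\mathfrak g$ such that: (1) $|[x_1,\cdots,x_n]|=|x_1|+\cdots+|x_n|$; (2) $[x_1,\cdots,x_i,x_{i+1},\cdots,x_n]=-(-1)^{|x_i||x_{i+1}|}[x_1,\cdots,x_{i+1},x_i,\cdots,x_n]$; (3) $[\alpha(x_1),\cdots,\alpha(x_{n-1}),[y_1,\cdots,y_n]]=\sum_{i=1}^n(-1)^{(|x_1|+\cdots+|x_{n-1}|)(|y_1|+\cdots+|y_{i-1}|)}[\alpha(y_1),\cdots,\alpha(y_{i-1}),[x_1,\cdots,x_{n-1},y_i],\alpha(y_{i+1}),\cdots,\alpha(y_n)]$;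 (4) $\alpha[x_1,\cdots,x_n]=[\alpha(x_1),\cdots,\alpha(x_n)]$ for all $x_1,\dots,x_n\in\mathfrak g$. A morphism from $(\mathfrak g,[\cdot,\cdots,\cdot],\alpha)$ to $(\mathfrak g',[\cdot,\cdots,\cdot]',\alpha')$ is a linear map $f:\mathfrak g\to\mathfrak g'$ satisfying $f[x_1,\cdots,x_n]=[f(x_1),\cdots,f(x_n)]'$ for all $x_1,\dots,x_n\in\mathfrak g$ and $f\circ\alpha=\alpha'\circ f$. A morphism of $\mathfrak g$ is a morphism from $(\mathfrak g,[\cdot,\cdots,\cdot],\alpha)$ to itself. Here $\beta\circ[\cdot,\cdots,\cdot]$ denotes the $n$-linear map $(x_1,\dots,x_n)\mapsto\beta([x_1,\cdots,x_n])$.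
   Formalization: The morphism β is additionally assumed to be even (degree-preserving); without this the claim fails, e.g. for ℂ = ℝ ⊕ iℝ with zero bracket, α = id and β multiplication by i, where β∘α is not even. *)

theory Defs
  imports Complex_Main "HOL-Library.Z2"
begin

locale super_vector_space = vector_space scale
  for scale :: "'k::field \<Rightarrow> 'g::ab_group_add \<Rightarrow> 'g" (infixr "*s" 75) +
  fixes G :: "bit \<Rightarrow> 'g set"
  assumes subspace_G: "subspace (G d)"
    and G_Int: "G 0 \<inter> G 1 = {0}"
    and G_sum: "\<exists>a\<in>G 0. \<exists>b\<in>G 1. x = a + b"

text \<open>The degree is rendered relationally: \<open>x \<in> G d\<close> says that \<open>x\<close> is homogeneous of
  degree \<open>d\<close>. The zero vector is thus homogeneous of both degrees, which is harmless.\<close>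

definition homogeneous_list :: "(bit \<Rightarrow> 'g set) \<Rightarrow> 'g list \<Rightarrow> bit list \<Rightarrow> bool" where
  "homogeneous_list G xs ds \<longleftrightarrow> list_all2 (\<lambda>x d. x \<in> G d) xs ds"

definition even_map :: "(bit \<Rightarrow> 'g set) \<Rightarrow> (bit \<Rightarrow> 'h set) \<Rightarrow> ('g \<Rightarrow> 'h) \<Rightarrow> bool" where
  "even_map G H f \<longleftrightarrow> (\<forall>d. \<forall>x\<in>G d. f x \<in> H d)"

text \<open>\<open>(-1)\<^sup>d\<close> for \<open>d\<close> in the integers modulo 2.\<close>

definition sign :: "bit \<Rightarrow> 'k::field" where
  "sign d = (if d = 0 then 1 else - 1)"

text \<open>An \<open>n\<close>-ary operation is a function on lists, of which only the values on lists of length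
  \<open>n\<close> matter. List positions are counted from 0.\<close>

definition multilinear ::
  "nat \<Rightarrow> ('k::field \<Rightarrow> 'g::ab_group_add \<Rightarrow> 'g) \<Rightarrow> ('g list \<Rightarrow> 'g) \<Rightarrow> bool" where
  "multilinear n s br \<longleftrightarrow>
     (\<forall>xs i. length xs = n \<longrightarrow> i < n \<longrightarrow> Vector_Spaces.linear s s (\<lambda>x. br (xs[i := x])))"

text \<open>Only the elements whose degree occurs in an identity are required to be homogeneous: the
  two swapped ones in \<open>skew\<close>, and all but the last \<open>y\<close> in \<open>nambu\<close>.\<close>

locale hom_nambu_lie_superalgebra = super_vector_space scale G
  for scale :: "'k::field \<Rightarrow> 'g::ab_group_add \<Rightarrow> 'g" (infixr "*s" 75)
    and G :: "bit \<Rightarrow> 'g set" +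
  fixes n :: nat and br :: "'g list \<Rightarrow> 'g" and \<alpha> :: "'g \<Rightarrow> 'g"
  assumes arity_pos: "n \<ge> 1"
    and multilinear_br: "multilinear n scale br"
    and linear_alpha: "Vector_Spaces.linear scale scale \<alpha>"
    and even_alpha: "even_map G G \<alpha>"
    and degree_br: "length xs = n \<Longrightarrow> homogeneous_list G xs ds \<Longrightarrow> br xs \<in> G (sum_list ds)"
    and skew: "length xs = n \<Longrightarrow> Suc i < n \<Longrightarrow> xs ! i \<in> G d \<Longrightarrow> xs ! Suc i \<in> G e \<Longrightarrow>
      br xs = - (sign (d * e) *s br (xs[i := xs ! Suc i, Suc i := xs ! i]))"
    and nambu: "length xs = n - 1 \<Longrightarrow> length ys = n \<Longrightarrow>
      homogeneous_list G xs ds \<Longrightarrow> homogeneous_list G (butlast ys) es \<Longrightarrow>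
      br (map \<alpha> xs @ [br ys]) =
        (\<Sum>i<n. sign (sum_list ds * sum_list (take i es)) *s
               br ((map \<alpha> ys)[i := br (xs @ [ys ! i])]))"
    and multiplicative: "length xs = n \<Longrightarrow> \<alpha> (br xs) = br (map \<alpha> xs)"

text \<open>Morphisms are not required to be even; evenness is stated separately with \<open>even_map\<close>.\<close>

definition hom_nambu_lie_morphism ::
  "nat \<Rightarrow> ('k::field \<Rightarrow> 'g::ab_group_add \<Rightarrow> 'g) \<Rightarrow> ('g list \<Rightarrow> 'g) \<Rightarrow> ('g \<Rightarrow> 'g) \<Rightarrow>
   ('k \<Rightarrow> 'h::ab_group_add \<Rightarrow> 'h) \<Rightarrow> ('h list \<Rightarrow> 'h) \<Rightarrow> ('h \<Rightarrow> 'h) \<Rightarrow> ('g \<Rightarrow> 'h) \<Rightarrow> bool" where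
  "hom_nambu_lie_morphism n s br \<alpha> s' br' \<alpha>' f \<longleftrightarrow>
     Vector_Spaces.linear s s' f \<and>
     (\<forall>xs. length xs = n \<longrightarrow> f (br xs) = br' (map f xs)) \<and>
     f \<circ> \<alpha> = \<alpha>' \<circ> f"

end

theory Submission
  imports Defs
begin

text \<open>Twisting by \<open>\<beta>\<close> turns each side of the Nambu identity into \<open>\<beta>\<^sup>2\<close> applied to the
  corresponding side of the original identity, since \<open>\<beta>\<close> can be pulled out of every bracket.\<close>

theorem theorem1p4:
  fixes scale :: "'k::field \<Rightarrow> 'g::ab_group_add \<Rightarrow> 'g"
    and G :: "bit \<Rightarrow> 'g set" and n :: nat
    and br :: "'g list \<Rightarrow> 'g" and \<alpha> \<beta> :: "'g \<Rightarrow> 'g"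
  assumes "hom_nambu_lie_superalgebra scale G n br \<alpha>"
    and "hom_nambu_lie_morphism n scale br \<alpha> scale br \<alpha> \<beta>"
    and "even_map G G \<beta>"
    and "\<beta> \<circ> \<alpha> = \<alpha> \<circ> \<beta>"
  shows "hom_nambu_lie_superalgebra scale G n (\<beta> \<circ> br) (\<beta> \<circ> \<alpha>)"
proof -
  interpret hom_nambu_lie_superalgebra scale G n br \<alpha> by (fact assms(1))
  have lin: "Vector_Spaces.linear scale scale \<beta>"
    and mor: "\<And>xs. length xs = n \<Longrightarrow> \<beta> (br xs) = br (map \<beta> xs)"
    using assms(2) by (auto simp: hom_nambu_lie_morphism_def)
  interpret b: Vector_Spaces.linear scale scale \<beta> by (fact lin)
  have comm: "\<alpha> (\<beta> x) = \<beta> (\<alpha> x)" for x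
    using assms(4) by (metis comp_apply)
  show ?thesis
  proof (intro hom_nambu_lie_superalgebra.intro hom_nambu_lie_superalgebra_axioms.intro)
    show "super_vector_space scale G" by (fact super_vector_space_axioms)
    show "1 \<le> n" by (fact arity_pos)
    \<comment> \<open>With all slots but one frozen, the new bracket is a linear map followed by the
      linear map \<open>\<beta>\<close>.\<close>
    show "multilinear n scale (\<beta> \<circ> br)"
      using multilinear_br Vector_Spaces.linear_compose[OF _ lin]
      unfolding multilinear_def by (fastforce simp: o_def)
    show "Vector_Spaces.linear scale scale (\<beta> \<circ> \<alpha>)"
      by (rule Vector_Spaces.linear_compose[OF linear_alpha lin])
    \<comment> \<open>A morphism may fail to be even, so degrees are controlled by
      \<open>assms(3)\<close>, here and for the bracket below.\<close>
    show "even_map G G (\<beta> \<circ> \<alpha>)"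
      using assms(3) even_alpha by (auto simp: even_map_def)
    show "(\<beta> \<circ> br) xs \<in> G (sum_list ds)"
      if "length xs = n" "homogeneous_list G xs ds" for xs ds
      using degree_br[OF that] assms(3) by (auto simp: even_map_def)
    show "(\<beta> \<circ> br) xs = - scale (sign (d * e)) ((\<beta> \<circ> br) (xs[i := xs ! Suc i, Suc i := xs ! i]))"
      if "length xs = n" "Suc i < n" "xs ! i \<in> G d" "xs ! Suc i \<in> G e" for xs i d e
      using arg_cong[OF skew[OF that], of \<beta>] by (simp add: b.neg b.scale)
    show "(\<beta> \<circ> br) (map (\<beta> \<circ> \<alpha>) xs @ [(\<beta> \<circ> br) ys]) =
        (\<Sum>i<n. scale (sign (sum_list ds * sum_list (take i es)))
               ((\<beta> \<circ> br) ((map (\<beta> \<circ> \<alpha>) ys)[i := (\<beta> \<circ> br) (xs @ [ys ! i])])))"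
      if len: "length xs = n - 1" "length ys = n"
        and hom: "homogeneous_list G xs ds" "homogeneous_list G (butlast ys) es" for xs ys ds es
    proof -
      \<comment> \<open>\<open>mor\<close> applies to lists of length \<open>n\<close> only;
        \<open>arity_pos\<close> makes the truncated \<open>n - 1\<close> plus one equal to
        \<open>n\<close>.\<close>
      have "(\<beta> \<circ> br) (map (\<beta> \<circ> \<alpha>) xs @ [(\<beta> \<circ> br) ys]) = \<beta> (\<beta> (br (map \<alpha> xs @ [br ys])))"
        using len arity_pos by (simp add: mor)
      \<comment> \<open>The signs depend only on the degrees \<open>ds\<close> and \<open>es\<close>
        of the original arguments, so linearity carries \<open>\<beta>\<close> past them
        unchanged.\<close>
      also have "\<dots> = (\<Sum>i<n. scale (sign (sum_list ds * sum_list (take i es)))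
          (\<beta> (\<beta> (br ((map \<alpha> ys)[i := br (xs @ [ys ! i])])))))"
        by (simp add: nambu[OF len hom] b.sum b.scale)
      \<comment> \<open>Only brackets of updated lists are rewritten by this instance of
        \<open>mor\<close>. The inner bracket of \<open>xs @ [ys ! i]\<close> stays intact and
        receives its \<open>\<beta>\<close> as the entry at position \<open>i\<close>, via
        \<open>map_update\<close>.\<close>
      also have "\<dots> = (\<Sum>i<n. scale (sign (sum_list ds * sum_list (take i es)))
               ((\<beta> \<circ> br) ((map (\<beta> \<circ> \<alpha>) ys)[i := (\<beta> \<circ> br) (xs @ [ys ! i])])))"
        using len by (simp add: mor[of "list_update _ _ _"] map_update)
      finally show ?thesis .
    qed
    \<comment> \<open>Moving \<open>\<alpha>\<close> past \<open>\<beta>\<close> and into the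
      bracket turns the left side into \<open>\<beta> (\<beta> (br (map \<alpha> xs)))\<close>; by
      \<open>mor\<close> the right side is the same.\<close>
    show "(\<beta> \<circ> \<alpha>) ((\<beta> \<circ> br) xs) = (\<beta> \<circ> br) (map (\<beta> \<circ> \<alpha>) xs)" if "length xs = n" for xs
      using that by (simp add: comm multiplicative mor[of "map _ _"])
  qed
qed

end
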